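(* In the setting below, let $\gamma$ be a generalizer, $\pi$ a permuter for $\gamma$, and $\gamma_\pi$ as defined below. If $\gamma$ is proper, then $\mathrm{GCG}_{\simeq}(\Phi,\psi,\gamma_\pi)$ is sound, terminating and complete up to isomorphisms (every execution terminates; every output $\sigma$ satisfies $\sigma\models\Phi$ and $M_\sigma\models\psi$; for every $\rho\models\Phi$ with $M_\rho\models\psi$, every execution outputs some $\sigma\simeq\rho$), it maintains Properties 1 and 2, and it maintains Property 3 (for the generalizer $\gamma_\pi$) as an invariant. If moreover $\gamma$ is invertible, then $\gamma_\pi$ is invertible and $\mathrm{GCG}_{\simeq}(\Phi,\psi,\gamma_\pi)$ maintains Property 4 as an invariant.
   Context: LTS setting. A labeled transition system (LTS) is $\langle\Sigma,Q,Q_0,\Delta\rangle$ (finite labels $\Sigma$, finite states $Q$, initial states $Q_0\subseteq Q$, $\Delta\subseteq Q\times\Sigma\times Q$). Fix an LTS $M_0=\langle\Sigma,Q,Q_0,\Delta_0\rangle$; a completion of $M_0$ is an LTS with the same $\Sigma,Q,Q_0$ and transition relation $\Delta\supseteq\Delta_0$. Let $V=\{x_{p,a,q}: p,q\in Q, a\in\Sigma\}$; an assignment $\sigma:V\to\{0,1\}$ encodes the LTS $M_\sigma$ with $\Sigma,Q,Q_0$ and $\Delta_\sigma=\{(p,a,q):\sigma(x_{p,a,q})=1\}$. $\Phi$ is a propositional formula over $V$ that implies $\bigwedge_{(p,a,q)\in\Delta_0}x_{p,a,q}$. Let $A$ be the set of non-initial states of $M_0$ with no incoming or outgoing transitions in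 $\Delta_0$. For assignments $\sigma,\rho$ satisfying $\Phi$, $\sigma\simeq\rho$ means there is a bijection $f:Q\to Q$ with $f(q)=q$ for $q\notin A$ such that $(p,a,q)\in\Delta_\sigma$ iff $(f(p),a,f(q))\in\Delta_\rho$. For $\rho\models\Phi$, $[\rho]=\{\sigma:\sigma\models\Phi,\ \sigma\simeq\rho\}$, also viewed as the formula satisfied exactly by its elements. $\psi$ is a specification with satisfaction relation $M\models\psi$, assumed invariant under isomorphism: if $\sigma\simeq\rho$ then $M_\sigma\models\psi$ iff $M_\rho\models\psi$. A generalizer maps assignments to formulas over $V$; $\gamma$ is proper if for every $\sigma\models\Phi$ with $M_\sigma\not\models\psi$: $\sigma\models\gamma(\sigma)$, and no $\rho$ with $\rho\models\Phi$, $M_\rho\models\psi$ satisfies $\gamma(\sigma)$. For a generalizer $g$ and assignment $\tau$, $g^{-1}(\tau)$ is the formula satisfied exactly by those $\sigma$ with $\tau\models g(\sigma)$. A formula $\varphi$ subsumes $\varphi'$ up to isomorphism if for every $\sigma\models\varphi$ there is $\sigma'\models\varphi'$ with $\sigma'\simeq\sigma$; they are equivalent up to isomorphism if each subsumes the other. $g$ is invertible if for all $\tau,\tau'$ satisfying $\Phi$ with $\tau\simeq\tau'$, $g^{-1}(\tau)$ and $g^{-1}(\tau')$ are equivalent up to isomorphism. A permuter for $\gamma$ is a function $\pi$ taking an assignment and a formula over $V$ and returning a formula over $V$, such that for every $\rho\models\Phi$ with $M_\rho\not\models\psi$ and every $\sigma\in[\rho]$, $\pi(\rho,\gamma(\sigma))$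 is logically equivalent to $\gamma(\rho)$. Define the generalizer $\gamma_\pi(\rho):=\bigvee_{\sigma\in[\rho]}\pi(\sigma,\gamma(\rho))$. Algorithm $\mathrm{GCG}_{\simeq}(\Phi,\psi,g)$: keep $\Phi_{cur}:=\Phi$; while $\Phi_{cur}$ is satisfiable, pick an arbitrary $\sigma\models\Phi_{cur}$ (a candidate); if $M_\sigma\models\psi$, output $\sigma$ (a solution) and set $\Phi_{cur}:=\Phi_{cur}\wedge\neg[\sigma]$; else set $\Phi_{cur}:=\Phi_{cur}\wedge\neg g(\sigma)$. In an execution, $\mathsf{Cand}$ and $\mathsf{Sol}$ are the sets of candidates and solutions (so far), and $\mathsf{Pruned}$ is the set of all assignments satisfying some formula $\varphi$ for which a step $\Phi_{cur}:=\Phi_{cur}\wedge\neg\varphi$ has been performed so far. Property 1: for every terminated execution and every $\sigma\models\Phi$, $[\sigma]\cap\mathsf{Sol}$ has at most one element. Property 2: for every terminated execution and every $\sigma\models\Phi$, $[\sigma]\cap\mathsf{Cand}$ has at most one element. Property 3 (invariant, for generalizer $g$): in every execution, at every point, for every $\sigma$ for which the step $\Phi_{cur}:=\Phi_{cur}\wedge\neg g(\sigma)$ has been performed so far and every $\rho\simeq\sigma$, every assignment satisfying $g(\rho)$ belongs to $\mathsf{Pruned}$. Property 4 (invariant): in every execution, at every point, for all $\tau,\tau'$ satisfying $\Phi$ with $\tau\in\mathsf{Pruned}$ and $\tau'\simeq\tau$, we have $\tau'\in\mathsf{Pruned}$ or $\tau'\in\mathsf{Sol}$.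
   Formalization: In the definition of invertible, g^{-1}(τ) ranges only over σ with σ⊨Φ and M_σ⊭ψ, not over all assignments; with all assignments, "γ_π is invertible" can fail because a permuter is unconstrained at solutions. *)

theory Defs
  imports Main
begin

datatype 'v form =
    Bot
  | Atom 'v
  | Neg "'v form"
  | Conj "'v form" "'v form"
  | Disj "'v form" "'v form"

primrec sat :: "('v \<Rightarrow> bool) \<Rightarrow> 'v form \<Rightarrow> bool" (infix "\<Turnstile>" 50) where
  "\<sigma> \<Turnstile> Bot \<longleftrightarrow> False"
| "\<sigma> \<Turnstile> Atom v \<longleftrightarrow> \<sigma> v"
| "\<sigma> \<Turnstile> Neg \<phi> \<longleftrightarrow> \<not> \<sigma> \<Turnstile> \<phi>"
| "\<sigma> \<Turnstile> Conj \<phi> \<phi>' \<longleftrightarrow> \<sigma> \<Turnstile> \<phi> \<and> \<sigma> \<Turnstile> \<phi>'"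
| "\<sigma> \<Turnstile> Disj \<phi> \<phi>' \<longleftrightarrow> \<sigma> \<Turnstile> \<phi> \<or> \<sigma> \<Turnstile> \<phi>'"

definition logically_equiv :: "'v form \<Rightarrow> 'v form \<Rightarrow> bool" where
  "logically_equiv \<phi> \<phi>' \<longleftrightarrow> (\<forall>\<tau>. \<tau> \<Turnstile> \<phi> \<longleftrightarrow> \<tau> \<Turnstile> \<phi>')"

(* The disjuncts of a finite family are listed in an arbitrary order. *)
definition big_disj :: "'i set \<Rightarrow> ('i \<Rightarrow> 'v form) \<Rightarrow> 'v form" where
  "big_disj I F = foldr (\<lambda>i \<phi>. Disj (F i) \<phi>) (SOME is. set is = I \<and> distinct is) Bot"

(* A formula satisfied exactly by the elements of S; by sat_form_of below it exists for
   every S when there are finitely many variables. *)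
definition form_of :: "('v \<Rightarrow> bool) set \<Rightarrow> 'v form" where
  "form_of S = (SOME \<phi>. \<forall>\<sigma>. \<sigma> \<Turnstile> \<phi> \<longleftrightarrow> \<sigma> \<in> S)"

lemma sat_big_disj:
  assumes "finite I"
  shows "\<tau> \<Turnstile> big_disj I F \<longleftrightarrow> (\<exists>i\<in>I. \<tau> \<Turnstile> F i)"
proof -
  have "set (SOME is. set is = I \<and> distinct is) = I"
    using someI_ex[OF finite_distinct_list[OF assms]] by blast
  moreover have "\<tau> \<Turnstile> foldr (\<lambda>i \<phi>. Disj (F i) \<phi>) is Bot \<longleftrightarrow> (\<exists>i\<in>set is. \<tau> \<Turnstile> F i)" for "is"
    by (induction "is") auto
  ultimately show ?thesis
    unfolding big_disj_def by simp
qed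

lemma sat_form_of:
  fixes \<sigma> :: "'v::finite \<Rightarrow> bool"
  shows "\<sigma> \<Turnstile> form_of S \<longleftrightarrow> \<sigma> \<in> S"
proof -
  define lit where "lit \<rho> v = (if \<rho> v then Neg (Atom v) else Atom v)" for \<rho> :: "'v \<Rightarrow> bool" and v
  have *: "\<sigma> \<Turnstile> Neg (big_disj UNIV (lit \<rho>)) \<longleftrightarrow> \<sigma> = \<rho>" for \<sigma> \<rho>
    by (auto simp: sat_big_disj lit_def fun_eq_iff)
  have "\<forall>\<sigma>. \<sigma> \<Turnstile> big_disj S (\<lambda>\<rho>. Neg (big_disj UNIV (lit \<rho>))) \<longleftrightarrow> \<sigma> \<in> S"
    using * by (subst sat_big_disj) auto
  then have "\<exists>\<phi>. \<forall>\<sigma>. \<sigma> \<Turnstile> \<phi> \<longleftrightarrow> \<sigma> \<in> S" ..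
  from someI_ex[OF this] show ?thesis
    unfolding form_of_def by blast
qed

(* The state set Q and the label set are the (finite) types 'q and 's. *)
type_synonym ('q, 's) transition = "'q \<times> 's \<times> 'q"

record ('q, 's) lts =
  initial :: "'q set"
  transitions :: "('q, 's) transition set"

(* The variable x_{p,a,q} is the transition (p, a, q) itself. *)
type_synonym ('q, 's) asg = "('q, 's) transition \<Rightarrow> bool"
type_synonym ('q, 's) fml = "('q, 's) transition form"
type_synonym ('q, 's) generalizer = "('q, 's) asg \<Rightarrow> ('q, 's) fml"

definition lts_of :: "('q, 's) lts \<Rightarrow> ('q, 's) asg \<Rightarrow> ('q, 's) lts" where
  "lts_of M0 \<sigma> = \<lparr>initial = initial M0, transitions = {t. \<sigma> t}\<rparr>"

definition isolated :: "('q, 's) lts \<Rightarrow> 'q set" where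
  "isolated M0 = {q. q \<notin> initial M0 \<and>
     (\<forall>a r. (q, a, r) \<notin> transitions M0 \<and> (r, a, q) \<notin> transitions M0)}"

definition iso :: "('q, 's) lts \<Rightarrow> ('q, 's) fml \<Rightarrow> ('q, 's) asg \<Rightarrow> ('q, 's) asg \<Rightarrow> bool" where
  "iso M0 \<Phi> \<sigma> \<rho> \<longleftrightarrow> \<sigma> \<Turnstile> \<Phi> \<and> \<rho> \<Turnstile> \<Phi> \<and>
     (\<exists>f. bij f \<and> (\<forall>q. q \<notin> isolated M0 \<longrightarrow> f q = q) \<and>
          (\<forall>p a q. (p, a, q) \<in> transitions (lts_of M0 \<sigma>)
               \<longleftrightarrow> (f p, a, f q) \<in> transitions (lts_of M0 \<rho>)))"

definition iso_class :: "('q, 's) lts \<Rightarrow> ('q, 's) fml \<Rightarrow> ('q, 's) asg \<Rightarrow> ('q, 's) asg set" where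
  "iso_class M0 \<Phi> \<rho> = {\<sigma>. \<sigma> \<Turnstile> \<Phi> \<and> iso M0 \<Phi> \<sigma> \<rho>}"

(* A specification is represented by the set of LTSs satisfying it. *)
type_synonym ('q, 's) spec = "('q, 's) lts \<Rightarrow> bool"

definition iso_invariant :: "('q, 's) lts \<Rightarrow> ('q, 's) fml \<Rightarrow> ('q, 's) spec \<Rightarrow> bool" where
  "iso_invariant M0 \<Phi> \<psi> \<longleftrightarrow>
     (\<forall>\<sigma> \<rho>. iso M0 \<Phi> \<sigma> \<rho> \<longrightarrow> (\<psi> (lts_of M0 \<sigma>) \<longleftrightarrow> \<psi> (lts_of M0 \<rho>)))"

definition counterexample ::
  "('q, 's) lts \<Rightarrow> ('q, 's) fml \<Rightarrow> ('q, 's) spec \<Rightarrow> ('q, 's) asg \<Rightarrow> bool" where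
  "counterexample M0 \<Phi> \<psi> \<sigma> \<longleftrightarrow> \<sigma> \<Turnstile> \<Phi> \<and> \<not> \<psi> (lts_of M0 \<sigma>)"

definition proper ::
  "('q, 's) lts \<Rightarrow> ('q, 's) fml \<Rightarrow> ('q, 's) spec \<Rightarrow> ('q, 's) generalizer \<Rightarrow> bool" where
  "proper M0 \<Phi> \<psi> \<gamma> \<longleftrightarrow> (\<forall>\<sigma>. counterexample M0 \<Phi> \<psi> \<sigma> \<longrightarrow>
     \<sigma> \<Turnstile> \<gamma> \<sigma> \<and> \<not> (\<exists>\<rho>. \<rho> \<Turnstile> \<Phi> \<and> \<psi> (lts_of M0 \<rho>) \<and> \<rho> \<Turnstile> \<gamma> \<sigma>))"

(* A generalizer is only ever applied to counterexamples, and neither properness nor the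
   permuter condition says anything about its values elsewhere.  These are therefore its
   domain of arguments when it is inverted.  Without this restriction gen_pi below need not
   be invertible: if no counterexample exists, every function is a permuter, and gen_pi is
   arbitrary at solutions. *)
definition gen_inverse ::
  "('q, 's) lts \<Rightarrow> ('q, 's) fml \<Rightarrow> ('q, 's) spec \<Rightarrow> ('q, 's) generalizer \<Rightarrow>
   ('q, 's) asg \<Rightarrow> ('q, 's) fml" where
  "gen_inverse M0 \<Phi> \<psi> g \<tau> = form_of {\<sigma>. counterexample M0 \<Phi> \<psi> \<sigma> \<and> \<tau> \<Turnstile> g \<sigma>}"

definition subsumes_iso :: "('q, 's) lts \<Rightarrow> ('q, 's) fml \<Rightarrow> ('q, 's) fml \<Rightarrow> ('q, 's) fml \<Rightarrow> bool" where
  "subsumes_iso M0 \<Phi> \<phi> \<phi>' \<longleftrightarrow> (\<forall>\<sigma>. \<sigma> \<Turnstile> \<phi> \<longrightarrow> (\<exists>\<sigma>'. \<sigma>' \<Turnstile> \<phi>' \<and> iso M0 \<Phi> \<sigma>' \<sigma>))"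

definition equiv_iso :: "('q, 's) lts \<Rightarrow> ('q, 's) fml \<Rightarrow> ('q, 's) fml \<Rightarrow> ('q, 's) fml \<Rightarrow> bool" where
  "equiv_iso M0 \<Phi> \<phi> \<phi>' \<longleftrightarrow> subsumes_iso M0 \<Phi> \<phi> \<phi>' \<and> subsumes_iso M0 \<Phi> \<phi>' \<phi>"

definition invertible ::
  "('q, 's) lts \<Rightarrow> ('q, 's) fml \<Rightarrow> ('q, 's) spec \<Rightarrow> ('q, 's) generalizer \<Rightarrow> bool" where
  "invertible M0 \<Phi> \<psi> g \<longleftrightarrow> (\<forall>\<tau> \<tau>'. \<tau> \<Turnstile> \<Phi> \<and> \<tau>' \<Turnstile> \<Phi> \<and> iso M0 \<Phi> \<tau> \<tau>' \<longrightarrow>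
     equiv_iso M0 \<Phi> (gen_inverse M0 \<Phi> \<psi> g \<tau>) (gen_inverse M0 \<Phi> \<psi> g \<tau>'))"

definition permuter ::
  "('q, 's) lts \<Rightarrow> ('q, 's) fml \<Rightarrow> ('q, 's) spec \<Rightarrow> ('q, 's) generalizer \<Rightarrow>
   (('q, 's) asg \<Rightarrow> ('q, 's) fml \<Rightarrow> ('q, 's) fml) \<Rightarrow> bool" where
  "permuter M0 \<Phi> \<psi> \<gamma> \<pi> \<longleftrightarrow> (\<forall>\<rho>. counterexample M0 \<Phi> \<psi> \<rho> \<longrightarrow>
     (\<forall>\<sigma>\<in>iso_class M0 \<Phi> \<rho>. logically_equiv (\<pi> \<rho> (\<gamma> \<sigma>)) (\<gamma> \<rho>)))"

definition gen_pi ::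
  "('q, 's) lts \<Rightarrow> ('q, 's) fml \<Rightarrow> ('q, 's) generalizer \<Rightarrow>
   (('q, 's) asg \<Rightarrow> ('q, 's) fml \<Rightarrow> ('q, 's) fml) \<Rightarrow> ('q, 's) generalizer" where
  "gen_pi M0 \<Phi> \<gamma> \<pi> \<rho> = big_disj (iso_class M0 \<Phi> \<rho>) (\<lambda>\<sigma>. \<pi> \<sigma> (\<gamma> \<rho>))"

(* State of the algorithm at the head of the loop, with history variables:
   generalized holds the candidates \<sigma> at which the step cur := cur \<and> \<not> g(\<sigma>) was performed,
   negated holds all formulas \<phi> for which a step cur := cur \<and> \<not> \<phi> was performed. *)
record ('q, 's) gcg_state =
  cur :: "('q, 's) fml"
  cand :: "('q, 's) asg set"
  sol :: "('q, 's) asg set"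
  generalized :: "('q, 's) asg set"
  negated :: "('q, 's) fml set"

definition pruned :: "('q, 's) gcg_state \<Rightarrow> ('q, 's) asg set" where
  "pruned s = {\<tau>. \<exists>\<phi>\<in>negated s. \<tau> \<Turnstile> \<phi>}"

definition gcg_init :: "('q, 's) fml \<Rightarrow> ('q, 's) gcg_state" where
  "gcg_init \<Phi> = \<lparr>cur = \<Phi>, cand = {}, sol = {}, generalized = {}, negated = {}\<rparr>"

inductive gcg_step ::
  "('q, 's) lts \<Rightarrow> ('q, 's) fml \<Rightarrow> ('q, 's) spec \<Rightarrow> ('q, 's) generalizer \<Rightarrow>
   ('q, 's) gcg_state \<Rightarrow> ('q, 's) gcg_state \<Rightarrow> bool"
  for M0 \<Phi> \<psi> g where
  solution: "\<lbrakk>\<sigma> \<Turnstile> cur s; \<psi> (lts_of M0 \<sigma>)\<rbrakk> \<Longrightarrow>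
    gcg_step M0 \<Phi> \<psi> g s
      (s\<lparr>cur := Conj (cur s) (Neg (form_of (iso_class M0 \<Phi> \<sigma>))),
         cand := insert \<sigma> (cand s),
         sol := insert \<sigma> (sol s),
         negated := insert (form_of (iso_class M0 \<Phi> \<sigma>)) (negated s)\<rparr>)"
| generalize: "\<lbrakk>\<sigma> \<Turnstile> cur s; \<not> \<psi> (lts_of M0 \<sigma>)\<rbrakk> \<Longrightarrow>
    gcg_step M0 \<Phi> \<psi> g s
      (s\<lparr>cur := Conj (cur s) (Neg (g \<sigma>)),
         cand := insert \<sigma> (cand s),
         generalized := insert \<sigma> (generalized s),
         negated := insert (g \<sigma>) (negated s)\<rparr>)"

definition gcg_reachable ::
  "('q, 's) lts \<Rightarrow> ('q, 's) fml \<Rightarrow> ('q, 's) spec \<Rightarrow> ('q, 's) generalizer \<Rightarrow>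
   ('q, 's) gcg_state \<Rightarrow> bool" where
  "gcg_reachable M0 \<Phi> \<psi> g s \<longleftrightarrow> (gcg_step M0 \<Phi> \<psi> g)\<^sup>*\<^sup>* (gcg_init \<Phi>) s"

definition gcg_terminated ::
  "('q, 's) lts \<Rightarrow> ('q, 's) fml \<Rightarrow> ('q, 's) spec \<Rightarrow> ('q, 's) generalizer \<Rightarrow>
   ('q, 's) gcg_state \<Rightarrow> bool" where
  "gcg_terminated M0 \<Phi> \<psi> g s \<longleftrightarrow>
     gcg_reachable M0 \<Phi> \<psi> g s \<and> \<not> (\<exists>\<sigma>. \<sigma> \<Turnstile> cur s)"

definition gcg_terminating ::
  "('q, 's) lts \<Rightarrow> ('q, 's) fml \<Rightarrow> ('q, 's) spec \<Rightarrow> ('q, 's) generalizer \<Rightarrow> bool" where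
  "gcg_terminating M0 \<Phi> \<psi> g \<longleftrightarrow>
     \<not> (\<exists>S :: nat \<Rightarrow> ('q, 's) gcg_state.
          S 0 = gcg_init \<Phi> \<and> (\<forall>i. gcg_step M0 \<Phi> \<psi> g (S i) (S (Suc i))))"

definition gcg_sound ::
  "('q, 's) lts \<Rightarrow> ('q, 's) fml \<Rightarrow> ('q, 's) spec \<Rightarrow> ('q, 's) generalizer \<Rightarrow> bool" where
  "gcg_sound M0 \<Phi> \<psi> g \<longleftrightarrow> (\<forall>s. gcg_reachable M0 \<Phi> \<psi> g s \<longrightarrow>
     (\<forall>\<sigma>\<in>sol s. \<sigma> \<Turnstile> \<Phi> \<and> \<psi> (lts_of M0 \<sigma>)))"

(* An execution that has not terminated may still lack solutions. *)
definition gcg_complete ::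
  "('q, 's) lts \<Rightarrow> ('q, 's) fml \<Rightarrow> ('q, 's) spec \<Rightarrow> ('q, 's) generalizer \<Rightarrow> bool" where
  "gcg_complete M0 \<Phi> \<psi> g \<longleftrightarrow> (\<forall>s. gcg_terminated M0 \<Phi> \<psi> g s \<longrightarrow>
     (\<forall>\<rho>. \<rho> \<Turnstile> \<Phi> \<and> \<psi> (lts_of M0 \<rho>) \<longrightarrow> (\<exists>\<sigma>\<in>sol s. iso M0 \<Phi> \<sigma> \<rho>)))"

definition property1 ::
  "('q, 's) lts \<Rightarrow> ('q, 's) fml \<Rightarrow> ('q, 's) spec \<Rightarrow> ('q, 's) generalizer \<Rightarrow> bool" where
  "property1 M0 \<Phi> \<psi> g \<longleftrightarrow> (\<forall>s. gcg_terminated M0 \<Phi> \<psi> g s \<longrightarrow>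
     (\<forall>\<sigma>. \<sigma> \<Turnstile> \<Phi> \<longrightarrow> (\<forall>\<tau> \<tau>'. \<tau> \<in> iso_class M0 \<Phi> \<sigma> \<inter> sol s \<and> \<tau>' \<in> iso_class M0 \<Phi> \<sigma> \<inter> sol s
        \<longrightarrow> \<tau> = \<tau>')))"

definition property2 ::
  "('q, 's) lts \<Rightarrow> ('q, 's) fml \<Rightarrow> ('q, 's) spec \<Rightarrow> ('q, 's) generalizer \<Rightarrow> bool" where
  "property2 M0 \<Phi> \<psi> g \<longleftrightarrow> (\<forall>s. gcg_terminated M0 \<Phi> \<psi> g s \<longrightarrow>
     (\<forall>\<sigma>. \<sigma> \<Turnstile> \<Phi> \<longrightarrow> (\<forall>\<tau> \<tau>'. \<tau> \<in> iso_class M0 \<Phi> \<sigma> \<inter> cand s \<and> \<tau>' \<in> iso_class M0 \<Phi> \<sigma> \<inter> cand s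
        \<longrightarrow> \<tau> = \<tau>')))"

definition property3 ::
  "('q, 's) lts \<Rightarrow> ('q, 's) fml \<Rightarrow> ('q, 's) spec \<Rightarrow> ('q, 's) generalizer \<Rightarrow> bool" where
  "property3 M0 \<Phi> \<psi> g \<longleftrightarrow> (\<forall>s. gcg_reachable M0 \<Phi> \<psi> g s \<longrightarrow>
     (\<forall>\<sigma>\<in>generalized s. \<forall>\<rho>. iso M0 \<Phi> \<rho> \<sigma> \<longrightarrow> (\<forall>\<tau>. \<tau> \<Turnstile> g \<rho> \<longrightarrow> \<tau> \<in> pruned s)))"

definition property4 ::
  "('q, 's) lts \<Rightarrow> ('q, 's) fml \<Rightarrow> ('q, 's) spec \<Rightarrow> ('q, 's) generalizer \<Rightarrow> bool" where
  "property4 M0 \<Phi> \<psi> g \<longleftrightarrow> (\<forall>s. gcg_reachable M0 \<Phi> \<psi> g s \<longrightarrow>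
     (\<forall>\<tau> \<tau>'. \<tau> \<Turnstile> \<Phi> \<and> \<tau>' \<Turnstile> \<Phi> \<and> \<tau> \<in> pruned s \<and> iso M0 \<Phi> \<tau>' \<tau>
        \<longrightarrow> \<tau>' \<in> pruned s \<or> \<tau>' \<in> sol s))"

end

theory Submission
  imports Defs
begin

text \<open>By the permuter law and isomorphism invariance, at a counterexample \<open>\<sigma>\<close> the formula
  \<open>gen_pi \<sigma>\<close> is equivalent to the disjunction of \<open>\<gamma> \<sigma>'\<close> over all \<open>\<sigma>' \<simeq> \<sigma>\<close>, so up to
  logical equivalence it depends only on the isomorphism class of \<open>\<sigma>\<close>.  Hence \<open>gen_pi\<close>
  inherits properness, and processing a candidate prunes its whole isomorphism class.  For
  invertibility, if \<open>\<tau> \<Turnstile> gen_pi \<sigma>\<close> then \<open>\<tau> \<Turnstile> \<gamma> \<sigma>'\<close> for some \<open>\<sigma>' \<simeq> \<sigma>\<close>; invertibility of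
  \<open>\<gamma>\<close> transports this to \<open>\<tau>' \<Turnstile> \<gamma> \<sigma>''\<close> with \<open>\<sigma>'' \<simeq> \<sigma>\<close>, so \<open>\<tau>' \<Turnstile> gen_pi \<sigma>\<close>.\<close>

section \<open>Isomorphism of assignments as an equivalence on the models of
  \<open>\<Phi>\<close>\<close>

lemma iso_refl: "\<sigma> \<Turnstile> \<Phi> \<Longrightarrow> iso M0 \<Phi> \<sigma> \<sigma>"
  unfolding iso_def by (auto intro!: exI[of _ id])

lemma iso_sym:
  assumes "iso M0 \<Phi> \<sigma> \<rho>"
  shows "iso M0 \<Phi> \<rho> \<sigma>"
proof -
  from assms obtain f where f: "bij f" "\<forall>q. q \<notin> isolated M0 \<longrightarrow> f q = q"
    "\<forall>p a q. (p, a, q) \<in> transitions (lts_of M0 \<sigma>)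
       \<longleftrightarrow> (f p, a, f q) \<in> transitions (lts_of M0 \<rho>)"
    unfolding iso_def by blast
  have "bij (inv f)" "\<forall>q. q \<notin> isolated M0 \<longrightarrow> inv f q = q"
    using f(1,2) by (metis bij_imp_bij_inv) (metis f(1,2) bij_is_inj inv_f_f)
  moreover have "\<forall>p a q. (p, a, q) \<in> transitions (lts_of M0 \<rho>)
       \<longleftrightarrow> (inv f p, a, inv f q) \<in> transitions (lts_of M0 \<sigma>)"
    using f(1,3) by (simp add: bij_is_surj surj_f_inv_f)
  ultimately show ?thesis
    using assms unfolding iso_def by blast
qed

lemma iso_trans:
  assumes "iso M0 \<Phi> \<sigma> \<rho>" and "iso M0 \<Phi> \<rho> \<tau>"
  shows "iso M0 \<Phi> \<sigma> \<tau>"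
proof -
  from assms(1) obtain f where f: "bij f" "\<forall>q. q \<notin> isolated M0 \<longrightarrow> f q = q"
    "\<forall>p a q. (p, a, q) \<in> transitions (lts_of M0 \<sigma>)
       \<longleftrightarrow> (f p, a, f q) \<in> transitions (lts_of M0 \<rho>)"
    unfolding iso_def by blast
  from assms(2) obtain h where h: "bij h" "\<forall>q. q \<notin> isolated M0 \<longrightarrow> h q = q"
    "\<forall>p a q. (p, a, q) \<in> transitions (lts_of M0 \<rho>)
       \<longleftrightarrow> (h p, a, h q) \<in> transitions (lts_of M0 \<tau>)"
    unfolding iso_def by blast
  have "bij (h \<circ> f)"
    using f(1) h(1) by (rule bij_comp)
  moreover have "\<forall>q. q \<notin> isolated M0 \<longrightarrow> (h \<circ> f) q = q"
    using f(2) h(2) by simp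
  moreover have "\<forall>p a q. (p, a, q) \<in> transitions (lts_of M0 \<sigma>)
       \<longleftrightarrow> ((h \<circ> f) p, a, (h \<circ> f) q) \<in> transitions (lts_of M0 \<tau>)"
    using f(3) h(3) by simp
  ultimately show ?thesis
    using assms unfolding iso_def by blast
qed

lemma iso_sat: "iso M0 \<Phi> \<sigma> \<rho> \<Longrightarrow> \<sigma> \<Turnstile> \<Phi> \<and> \<rho> \<Turnstile> \<Phi>"
  unfolding iso_def by blast

lemma mem_iso_class: "\<sigma> \<in> iso_class M0 \<Phi> \<rho> \<longleftrightarrow> iso M0 \<Phi> \<sigma> \<rho>"
  unfolding iso_class_def by (auto dest: iso_sat)

lemma counterexample_iso:
  assumes "iso_invariant M0 \<Phi> \<psi>" and "iso M0 \<Phi> \<sigma> \<rho>"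
  shows "counterexample M0 \<Phi> \<psi> \<sigma> \<longleftrightarrow> counterexample M0 \<Phi> \<psi> \<rho>"
  using assms iso_sat[OF assms(2)] unfolding iso_invariant_def counterexample_def by blast

lemma sat_gen_inverse:
  fixes M0 :: "('q::finite, 's::finite) lts"
  shows "\<sigma> \<Turnstile> gen_inverse M0 \<Phi> \<psi> g \<tau> \<longleftrightarrow> counterexample M0 \<Phi> \<psi> \<sigma> \<and> \<tau> \<Turnstile> g \<sigma>"
  unfolding gen_inverse_def by (simp add: sat_form_of)

text \<open>Invertibility as a transfer rule: moving \<open>\<tau>\<close> within its class is paid
  for by moving \<open>\<sigma>\<close> within its own.\<close>

lemma invertibleD:
  fixes M0 :: "('q::finite, 's::finite) lts"
  assumes "invertible M0 \<Phi> \<psi> g" and "iso M0 \<Phi> \<tau> \<tau>'"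
    and "counterexample M0 \<Phi> \<psi> \<sigma>" and "\<tau> \<Turnstile> g \<sigma>"
  obtains \<sigma>' where "iso M0 \<Phi> \<sigma>' \<sigma>" and "\<tau>' \<Turnstile> g \<sigma>'"
proof -
  have "subsumes_iso M0 \<Phi> (gen_inverse M0 \<Phi> \<psi> g \<tau>) (gen_inverse M0 \<Phi> \<psi> g \<tau>')"
    using assms(1,2) iso_sat[OF assms(2)] unfolding invertible_def equiv_iso_def by blast
  then show thesis
    using that assms(3,4) unfolding subsumes_iso_def sat_gen_inverse by blast
qed


section \<open>Executions with a generalizer that respects isomorphism\<close>

text \<open>Besides properness, this is what the analysis of executions asks of a generalizer up to
  Property 3. An implication suffices: under \<open>iso_invariant\<close>, exchanging
  \<open>\<sigma>\<close> and \<open>\<rho>\<close> gives the converse.\<close>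

definition respects_iso ::
  "('q, 's) lts \<Rightarrow> ('q, 's) fml \<Rightarrow> ('q, 's) spec \<Rightarrow> ('q, 's) generalizer \<Rightarrow> bool" where
  "respects_iso M0 \<Phi> \<psi> g \<longleftrightarrow> (\<forall>\<sigma> \<rho> \<tau>.
     counterexample M0 \<Phi> \<psi> \<sigma> \<and> iso M0 \<Phi> \<rho> \<sigma> \<and> \<tau> \<Turnstile> g \<rho> \<longrightarrow> \<tau> \<Turnstile> g \<sigma>)"

text \<open>The loop invariant, tying the formula \<open>cur\<close> to the history variables.
  Recording \<open>negated\<close> exactly lets \<open>pruned\<close> be split by the kind of
  step.\<close>

definition gcg_history ::
  "('q, 's) lts \<Rightarrow> ('q, 's) fml \<Rightarrow> ('q, 's) spec \<Rightarrow> ('q, 's) generalizer \<Rightarrow>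
   ('q, 's) gcg_state \<Rightarrow> bool" where
  "gcg_history M0 \<Phi> \<psi> g s \<longleftrightarrow>
     (\<forall>\<tau>. \<tau> \<Turnstile> cur s \<longleftrightarrow> \<tau> \<Turnstile> \<Phi> \<and> \<tau> \<notin> pruned s) \<and>
     cand s = sol s \<union> generalized s \<and>
     negated s = (\<lambda>\<sigma>. form_of (iso_class M0 \<Phi> \<sigma>)) ` sol s \<union> g ` generalized s \<and>
     (\<forall>\<sigma>\<in>sol s. \<sigma> \<Turnstile> \<Phi> \<and> \<psi> (lts_of M0 \<sigma>)) \<and>
     (\<forall>\<sigma>\<in>generalized s. counterexample M0 \<Phi> \<psi> \<sigma>)"

lemma gcg_history_step:
  assumes "gcg_step M0 \<Phi> \<psi> g s s'" and "gcg_history M0 \<Phi> \<psi> g s"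
  shows "gcg_history M0 \<Phi> \<psi> g s'"
  using assms by cases (auto simp: gcg_history_def pruned_def counterexample_def)

lemma gcg_history_reachable:
  assumes "gcg_reachable M0 \<Phi> \<psi> g s"
  shows "gcg_history M0 \<Phi> \<psi> g s"
  using assms unfolding gcg_reachable_def
proof (induction rule: rtranclp_induct)
  case base
  show ?case by (simp add: gcg_history_def gcg_init_def pruned_def)
next
  case (step s s')
  then show ?case by (blast intro: gcg_history_step)
qed

lemma pruned_iff:
  fixes M0 :: "('q::finite, 's::finite) lts"
  assumes "gcg_reachable M0 \<Phi> \<psi> g s"
  shows "\<tau> \<in> pruned s \<longleftrightarrow>
    (\<exists>\<sigma>\<in>sol s. iso M0 \<Phi> \<tau> \<sigma>) \<or> (\<exists>\<sigma>\<in>generalized s. \<tau> \<Turnstile> g \<sigma>)"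
proof -
  have "negated s = (\<lambda>\<sigma>. form_of (iso_class M0 \<Phi> \<sigma>)) ` sol s \<union> g ` generalized s"
    using gcg_history_reachable[OF assms] unfolding gcg_history_def by blast
  then show ?thesis
    by (simp add: pruned_def bex_Un sat_form_of mem_iso_class)
qed

lemma sat_cur_iff:
  assumes "gcg_reachable M0 \<Phi> \<psi> g s"
  shows "\<tau> \<Turnstile> cur s \<longleftrightarrow> \<tau> \<Turnstile> \<Phi> \<and> \<tau> \<notin> pruned s"
  using gcg_history_reachable[OF assms] unfolding gcg_history_def by blast

lemma generalized_counterexample:
  assumes "gcg_reachable M0 \<Phi> \<psi> g s" and "\<sigma> \<in> generalized s"
  shows "counterexample M0 \<Phi> \<psi> \<sigma>"
  using gcg_history_reachable[OF assms(1)] assms(2) unfolding gcg_history_def by blast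

lemma gcg_reachable_step:
  "gcg_reachable M0 \<Phi> \<psi> g s \<Longrightarrow> gcg_step M0 \<Phi> \<psi> g s s' \<Longrightarrow> gcg_reachable M0 \<Phi> \<psi> g s'"
  unfolding gcg_reachable_def by (rule rtranclp.rtrancl_into_rtrancl)

lemma gcg_sound: "gcg_sound M0 \<Phi> \<psi> g"
  unfolding gcg_sound_def using gcg_history_reachable unfolding gcg_history_def by blast

text \<open>At termination \<open>cur\<close> has no model, so \<open>\<rho>\<close> was pruned.
  Properness rules out every generalization step as the cause, which leaves the class of some
  solution.\<close>

lemma gcg_complete:
  fixes M0 :: "('q::finite, 's::finite) lts"
  assumes "proper M0 \<Phi> \<psi> g"
  shows "gcg_complete M0 \<Phi> \<psi> g"
  unfolding gcg_complete_def
proof (intro allI impI, elim conjE)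
  fix s \<rho>
  assume s: "gcg_terminated M0 \<Phi> \<psi> g s" and \<rho>: "\<rho> \<Turnstile> \<Phi>" "\<psi> (lts_of M0 \<rho>)"
  from s have r: "gcg_reachable M0 \<Phi> \<psi> g s" and "\<not> \<rho> \<Turnstile> cur s"
    unfolding gcg_terminated_def by blast+
  then have "\<rho> \<in> pruned s"
    using \<rho>(1) by (simp add: sat_cur_iff)
  moreover have "\<not> \<rho> \<Turnstile> g \<sigma>" if "\<sigma> \<in> generalized s" for \<sigma>
    using generalized_counterexample[OF r that] assms \<rho> unfolding proper_def by blast
  ultimately show "\<exists>\<sigma>\<in>sol s. iso M0 \<Phi> \<sigma> \<rho>"
    unfolding pruned_iff[OF r] by (blast intro: iso_sym)
qed

text \<open>A solution step negates the class outright. If \<open>\<sigma>\<close> was generalized,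
  then \<open>\<tau>\<close> is a counterexample too, properness gives
  \<open>\<tau> \<Turnstile> g \<tau>\<close>, and \<open>respects_iso\<close> moves this to
  \<open>g \<sigma>\<close>. Termination and Property 2 both rest on this.\<close>

lemma candidate_class_pruned:
  fixes M0 :: "('q::finite, 's::finite) lts"
  assumes "iso_invariant M0 \<Phi> \<psi>" and "proper M0 \<Phi> \<psi> g" and "respects_iso M0 \<Phi> \<psi> g"
    and r: "gcg_reachable M0 \<Phi> \<psi> g s" and "\<sigma> \<in> cand s" and "iso M0 \<Phi> \<tau> \<sigma>"
  shows "\<tau> \<in> pruned s"
proof -
  have "\<tau> \<Turnstile> g \<sigma>" if "\<sigma> \<in> generalized s"
  proof -
    have "counterexample M0 \<Phi> \<psi> \<sigma>"
      using r that by (rule generalized_counterexample)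
    moreover from this have "\<tau> \<Turnstile> g \<tau>"
      using counterexample_iso[OF assms(1,6)] assms(2) unfolding proper_def by blast
    ultimately show ?thesis
      using assms(3,6) unfolding respects_iso_def by blast
  qed
  moreover have "cand s = sol s \<union> generalized s"
    using gcg_history_reachable[OF r] unfolding gcg_history_def by blast
  ultimately show ?thesis
    unfolding pruned_iff[OF r] using assms(5,6) by blast
qed

lemma gcg_step_cases:
  assumes "gcg_step M0 \<Phi> \<psi> g s s'"
  obtains \<sigma> \<phi> where "\<sigma> \<Turnstile> cur s" and "cand s' = insert \<sigma> (cand s)"
    and "cur s' = Conj (cur s) (Neg \<phi>)"
  using assms by cases auto

lemma gcg_terminating:
  fixes M0 :: "('q::finite, 's::finite) lts"
  assumes "iso_invariant M0 \<Phi> \<psi>" and "proper M0 \<Phi> \<psi> g" and "respects_iso M0 \<Phi> \<psi> g"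
  shows "gcg_terminating M0 \<Phi> \<psi> g"
  unfolding gcg_terminating_def
proof
  assume "\<exists>S. S 0 = gcg_init \<Phi> \<and> (\<forall>i. gcg_step M0 \<Phi> \<psi> g (S i) (S (Suc i)))"
  then obtain S where S0: "S 0 = gcg_init \<Phi>"
    and step: "\<And>i. gcg_step M0 \<Phi> \<psi> g (S i) (S (Suc i))"
    by blast
  have r: "gcg_reachable M0 \<Phi> \<psi> g (S i)" for i
  proof (induction i)
    case 0
    show ?case by (simp add: S0 gcg_reachable_def)
  next
    case (Suc i)
    then show ?case using step by (rule gcg_reachable_step)
  qed
  \<comment> \<open>Each step loses at least its own candidate as a model of \<open>cur\<close>.
    Finite state and label types make these cardinalities meaningful.\<close>
  have "card {\<tau>. \<tau> \<Turnstile> cur (S (Suc i))} < card {\<tau>. \<tau> \<Turnstile> cur (S i)}" for i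
  proof (rule psubset_card_mono)
    obtain \<sigma> \<phi> where \<sigma>: "\<sigma> \<Turnstile> cur (S i)" and c: "cand (S (Suc i)) = insert \<sigma> (cand (S i))"
      and n: "cur (S (Suc i)) = Conj (cur (S i)) (Neg \<phi>)"
      using step by (rule gcg_step_cases)
    have "\<sigma> \<Turnstile> \<Phi>"
      using \<sigma> by (simp add: sat_cur_iff[OF r])
    then have "\<sigma> \<in> pruned (S (Suc i))"
      using candidate_class_pruned[OF assms r] c by (blast intro: iso_refl)
    then have "\<not> \<sigma> \<Turnstile> cur (S (Suc i))"
      by (simp add: sat_cur_iff[OF r])
    with \<sigma> n show "{\<tau>. \<tau> \<Turnstile> cur (S (Suc i))} \<subset> {\<tau>. \<tau> \<Turnstile> cur (S i)}"
      by auto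
  qed simp
  then show False
    using wf_no_infinite_down_chainE[OF wf_measure, of "\<lambda>i. i" "\<lambda>i. card {\<tau>. \<tau> \<Turnstile> cur (S i)}"]
    by simp
qed

text \<open>A new candidate satisfies \<open>cur\<close> and so is not pruned, whereas everything
  isomorphic to an earlier candidate is.\<close>

lemma candidates_unique:
  fixes M0 :: "('q::finite, 's::finite) lts"
  assumes "iso_invariant M0 \<Phi> \<psi>" and "proper M0 \<Phi> \<psi> g" and "respects_iso M0 \<Phi> \<psi> g"
    and "gcg_reachable M0 \<Phi> \<psi> g s"
    and "\<tau> \<in> cand s" and "\<tau>' \<in> cand s" and "iso M0 \<Phi> \<tau> \<tau>'"
  shows "\<tau> = \<tau>'"
  using assms(4-) unfolding gcg_reachable_def
proof (induction arbitrary: \<tau> \<tau>' rule: rtranclp_induct)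
  case base
  then show ?case by (simp add: gcg_init_def)
next
  case (step s s')
  have r: "gcg_reachable M0 \<Phi> \<psi> g s"
    using step.hyps(1) by (simp add: gcg_reachable_def)
  obtain \<sigma> where \<sigma>: "\<sigma> \<Turnstile> cur s" and c: "cand s' = insert \<sigma> (cand s)"
    using step.hyps(2) by (rule gcg_step_cases)
  \<comment> \<open>Both orientations are stated because either of \<open>\<tau>\<close>,
    \<open>\<tau>'\<close> may be the new candidate.\<close>
  have new: "\<not> iso M0 \<Phi> \<sigma> \<rho>" "\<not> iso M0 \<Phi> \<rho> \<sigma>" if "\<rho> \<in> cand s" for \<rho>
    using candidate_class_pruned[OF assms(1-3) r that] \<sigma> sat_cur_iff[OF r] iso_sym by blast+
  show ?case
    using step.prems step.IH new unfolding c by blast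
qed

lemma property2:
  fixes M0 :: "('q::finite, 's::finite) lts"
  assumes "iso_invariant M0 \<Phi> \<psi>" and "proper M0 \<Phi> \<psi> g" and "respects_iso M0 \<Phi> \<psi> g"
  shows "property2 M0 \<Phi> \<psi> g"
  using candidates_unique[OF assms]
  unfolding property2_def gcg_terminated_def mem_iso_class Int_iff by (meson iso_trans iso_sym)

lemma property1:
  assumes "property2 M0 \<Phi> \<psi> g"
  shows "property1 M0 \<Phi> \<psi> g"
proof -
  have "sol s \<subseteq> cand s" if "gcg_terminated M0 \<Phi> \<psi> g s" for s
    using that gcg_history_reachable unfolding gcg_terminated_def gcg_history_def by blast
  then show ?thesis
    using assms unfolding property1_def property2_def by blast
qed

text \<open>Since \<open>\<sigma>\<close> is a counterexample, every model of
  \<open>g \<rho>\<close> is a model of \<open>g \<sigma>\<close>, which was negated.\<close>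

lemma property3:
  fixes M0 :: "('q::finite, 's::finite) lts"
  assumes "respects_iso M0 \<Phi> \<psi> g"
  shows "property3 M0 \<Phi> \<psi> g"
  unfolding property3_def
  using assms generalized_counterexample pruned_iff unfolding respects_iso_def by blast

lemma property4:
  fixes M0 :: "('q::finite, 's::finite) lts"
  assumes "respects_iso M0 \<Phi> \<psi> g" and "invertible M0 \<Phi> \<psi> g"
  shows "property4 M0 \<Phi> \<psi> g"
  unfolding property4_def
proof (intro allI impI, elim conjE)
  fix s \<tau> \<tau>'
  assume r: "gcg_reachable M0 \<Phi> \<psi> g s" and "\<tau> \<in> pruned s" and i: "iso M0 \<Phi> \<tau>' \<tau>"
  then consider \<sigma> where "\<sigma> \<in> sol s" "iso M0 \<Phi> \<tau> \<sigma>" | \<sigma> where "\<sigma> \<in> generalized s" "\<tau> \<Turnstile> g \<sigma>"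
    unfolding pruned_iff[OF r] by blast
  \<comment> \<open>The first disjunct always holds: a solution step negates the whole class, the
    solution included.\<close>
  then have "\<tau>' \<in> pruned s"
  proof cases
    case 1
    then show ?thesis
      using i unfolding pruned_iff[OF r] by (blast intro: iso_trans)
  next
    case (2 \<sigma>)
    have ce: "counterexample M0 \<Phi> \<psi> \<sigma>"
      using r 2(1) by (rule generalized_counterexample)
    obtain \<sigma>' where "iso M0 \<Phi> \<sigma>' \<sigma>" "\<tau>' \<Turnstile> g \<sigma>'"
      using assms(2) iso_sym[OF i] ce 2(2) by (rule invertibleD)
    \<comment> \<open>Invertibility only yields some \<open>\<sigma>'\<close> in the class of
      \<open>\<sigma>\<close>; \<open>respects_iso\<close> returns to the candidate actually
      processed.\<close>
    then have "\<tau>' \<Turnstile> g \<sigma>"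
      using assms(1) ce unfolding respects_iso_def by blast
    then show ?thesis
      using 2(1) unfolding pruned_iff[OF r] by blast
  qed
  then show "\<tau>' \<in> pruned s \<or> \<tau>' \<in> sol s" ..
qed


section \<open>The generalizer of a permuter\<close>

lemma sat_gen_pi:
  fixes M0 :: "('q::finite, 's::finite) lts"
  assumes "iso_invariant M0 \<Phi> \<psi>" and "permuter M0 \<Phi> \<psi> \<gamma> \<pi>" and "counterexample M0 \<Phi> \<psi> \<sigma>"
  shows "\<tau> \<Turnstile> gen_pi M0 \<Phi> \<gamma> \<pi> \<sigma> \<longleftrightarrow> (\<exists>\<sigma>'. iso M0 \<Phi> \<sigma>' \<sigma> \<and> \<tau> \<Turnstile> \<gamma> \<sigma>')"
proof -
  \<comment> \<open>The permuter law is read at the counterexample \<open>\<sigma>'\<close>, with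
    \<open>\<sigma>\<close> as the member of its class.\<close>
  have "\<tau> \<Turnstile> \<pi> \<sigma>' (\<gamma> \<sigma>) \<longleftrightarrow> \<tau> \<Turnstile> \<gamma> \<sigma>'" if "iso M0 \<Phi> \<sigma>' \<sigma>" for \<sigma>'
    using assms(2,3) counterexample_iso[OF assms(1) that] iso_sym[OF that]
    unfolding permuter_def logically_equiv_def mem_iso_class[symmetric] by blast
  then show ?thesis
    unfolding gen_pi_def by (auto simp: sat_big_disj mem_iso_class)
qed

text \<open>The disjunct of \<open>\<sigma>\<close> itself covers \<open>\<sigma>\<close>. Every
  other disjunct also comes from a counterexample, so properness of \<open>\<gamma>\<close> keeps
  solutions out.\<close>

lemma proper_gen_pi:
  fixes M0 :: "('q::finite, 's::finite) lts"
  assumes "iso_invariant M0 \<Phi> \<psi>" and "permuter M0 \<Phi> \<psi> \<gamma> \<pi>" and "proper M0 \<Phi> \<psi> \<gamma>"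
  shows "proper M0 \<Phi> \<psi> (gen_pi M0 \<Phi> \<gamma> \<pi>)"
  unfolding proper_def
proof (intro allI impI conjI notI; (elim exE conjE)?)
  fix \<sigma>
  assume ce: "counterexample M0 \<Phi> \<psi> \<sigma>"
  then have "\<sigma> \<Turnstile> \<gamma> \<sigma>" "iso M0 \<Phi> \<sigma> \<sigma>"
    using assms(3) unfolding proper_def by (auto simp: counterexample_def iso_refl)
  then show "\<sigma> \<Turnstile> gen_pi M0 \<Phi> \<gamma> \<pi> \<sigma>"
    unfolding sat_gen_pi[OF assms(1,2) ce] by blast
next
  fix \<sigma> \<rho>
  assume ce: "counterexample M0 \<Phi> \<psi> \<sigma>" and \<rho>: "\<rho> \<Turnstile> \<Phi>" "\<psi> (lts_of M0 \<rho>)"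
    and "\<rho> \<Turnstile> gen_pi M0 \<Phi> \<gamma> \<pi> \<sigma>"
  then obtain \<sigma>' where "iso M0 \<Phi> \<sigma>' \<sigma>" and "\<rho> \<Turnstile> \<gamma> \<sigma>'"
    unfolding sat_gen_pi[OF assms(1,2) ce] by blast
  then show False
    using \<rho> ce counterexample_iso[OF assms(1)] assms(3) unfolding proper_def by blast
qed

text \<open>By transitivity, the disjunctions at isomorphic counterexamples range over the same
  class.\<close>

lemma respects_iso_gen_pi:
  fixes M0 :: "('q::finite, 's::finite) lts"
  assumes "iso_invariant M0 \<Phi> \<psi>" and "permuter M0 \<Phi> \<psi> \<gamma> \<pi>"
  shows "respects_iso M0 \<Phi> \<psi> (gen_pi M0 \<Phi> \<gamma> \<pi>)"
  unfolding respects_iso_def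
  using counterexample_iso[OF assms(1)] sat_gen_pi[OF assms] iso_trans by blast

lemma invertible_gen_pi:
  fixes M0 :: "('q::finite, 's::finite) lts"
  assumes "iso_invariant M0 \<Phi> \<psi>" and "permuter M0 \<Phi> \<psi> \<gamma> \<pi>" and "invertible M0 \<Phi> \<psi> \<gamma>"
  shows "invertible M0 \<Phi> \<psi> (gen_pi M0 \<Phi> \<gamma> \<pi>)"
proof -
  let ?g = "gen_pi M0 \<Phi> \<gamma> \<pi>"
  have "subsumes_iso M0 \<Phi> (gen_inverse M0 \<Phi> \<psi> ?g \<tau>) (gen_inverse M0 \<Phi> \<psi> ?g \<tau>')"
    if i: "iso M0 \<Phi> \<tau> \<tau>'" for \<tau> \<tau>'
    unfolding subsumes_iso_def sat_gen_inverse
  proof (intro allI impI, elim conjE)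
    fix \<sigma>
    assume ce: "counterexample M0 \<Phi> \<psi> \<sigma>" and "\<tau> \<Turnstile> ?g \<sigma>"
    then obtain \<sigma>' where \<sigma>': "iso M0 \<Phi> \<sigma>' \<sigma>" "\<tau> \<Turnstile> \<gamma> \<sigma>'"
      unfolding sat_gen_pi[OF assms(1,2) ce] by blast
    obtain \<sigma>'' where "iso M0 \<Phi> \<sigma>'' \<sigma>'" "\<tau>' \<Turnstile> \<gamma> \<sigma>''"
      using assms(3) i _ \<sigma>'(2)
    proof (rule invertibleD)
      show "counterexample M0 \<Phi> \<psi> \<sigma>'"
        using counterexample_iso[OF assms(1) \<sigma>'(1)] ce by blast
    qed
    then have "\<tau>' \<Turnstile> ?g \<sigma>"
      unfolding sat_gen_pi[OF assms(1,2) ce] using \<sigma>'(1) by (blast intro: iso_trans)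
    \<comment> \<open>The witness for subsumption is \<open>\<sigma>\<close> itself, since
      \<open>\<sigma>''\<close> lies in its class and is absorbed by the disjunction.\<close>
    moreover have "iso M0 \<Phi> \<sigma> \<sigma>"
      using ce by (simp add: counterexample_def iso_refl)
    ultimately show "\<exists>\<sigma>'. (counterexample M0 \<Phi> \<psi> \<sigma>' \<and> \<tau>' \<Turnstile> ?g \<sigma>') \<and> iso M0 \<Phi> \<sigma>' \<sigma>"
      using ce by blast
  qed
  \<comment> \<open>The other subsumption is the same claim with \<open>\<tau>\<close> and
    \<open>\<tau>'\<close> exchanged.\<close>
  then show ?thesis
    unfolding invertible_def equiv_iso_def by (blast intro: iso_sym)
qed

theorem theorem7:
  fixes M0 :: "('q::finite, 's::finite) lts"
    and \<Phi> :: "('q, 's) fml"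
    and \<psi> :: "('q, 's) spec"
    and \<gamma> :: "('q, 's) generalizer"
    and \<pi> :: "('q, 's) asg \<Rightarrow> ('q, 's) fml \<Rightarrow> ('q, 's) fml"
  assumes "\<And>\<sigma> t. \<sigma> \<Turnstile> \<Phi> \<Longrightarrow> t \<in> transitions M0 \<Longrightarrow> \<sigma> \<Turnstile> Atom t"
    and "iso_invariant M0 \<Phi> \<psi>"
    and "permuter M0 \<Phi> \<psi> \<gamma> \<pi>"
    and "proper M0 \<Phi> \<psi> \<gamma>"
  shows "gcg_sound M0 \<Phi> \<psi> (gen_pi M0 \<Phi> \<gamma> \<pi>)
       \<and> gcg_terminating M0 \<Phi> \<psi> (gen_pi M0 \<Phi> \<gamma> \<pi>)
       \<and> gcg_complete M0 \<Phi> \<psi> (gen_pi M0 \<Phi> \<gamma> \<pi>)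
       \<and> property1 M0 \<Phi> \<psi> (gen_pi M0 \<Phi> \<gamma> \<pi>)
       \<and> property2 M0 \<Phi> \<psi> (gen_pi M0 \<Phi> \<gamma> \<pi>)
       \<and> property3 M0 \<Phi> \<psi> (gen_pi M0 \<Phi> \<gamma> \<pi>)
       \<and> (invertible M0 \<Phi> \<psi> \<gamma> \<longrightarrow>
            invertible M0 \<Phi> \<psi> (gen_pi M0 \<Phi> \<gamma> \<pi>)
          \<and> property4 M0 \<Phi> \<psi> (gen_pi M0 \<Phi> \<gamma> \<pi>))"
proof -
  note proper = proper_gen_pi[OF assms(2-4)] and resp = respects_iso_gen_pi[OF assms(2,3)]
  show ?thesis
    using gcg_sound gcg_terminating[OF assms(2) proper resp] gcg_complete[OF proper]
      property1[OF property2[OF assms(2) proper resp]] property2[OF assms(2) proper resp]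
      property3[OF resp] property4[OF resp] invertible_gen_pi[OF assms(2,3)]
    by blast
qed

end
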